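(* Let $I\subseteq\mathbb{R}$ be an interval and let $f:I\to\mathbb{R}$ be a differentiable function on $I^{\circ}$, the interior of $I$, such that $f'\in L[a,b]$, where $a,b\in I$ with $a<b$. Then for all $x\in[a,b]$, $\lambda\in[0,1]$ and $\alpha>0$, $$S_{f}(x,\lambda,\alpha,a,b)=\frac{(x-a)^{\alpha+1}}{b-a}\int_{0}^{1}(t^{\alpha}-\lambda)\,f'(tx+(1-t)a)\,dt+\frac{(b-x)^{\alpha+1}}{b-a}\int_{0}^{1}(\lambda-t^{\alpha})\,f'(tx+(1-t)b)\,dt .$$
   Context: $L[a,b]$ denotes the space of Lebesgue integrable functions on $[a,b]$ and $\Gamma$ is the Euler Gamma function, $\Gamma(\alpha)=\int_{0}^{\infty}e^{-t}t^{\alpha-1}\,dt$. For $\alpha>0$ and $x\in[a,b]$ the Riemann–Liouville fractional integrals appearing below are $J_{x^{-}}^{\alpha}f(a)=\frac{1}{\Gamma(\alpha)}\int_{a}^{x}(t-a)^{\alpha-1}f(t)\,dt$ and $J_{x^{+}}^{\alpha}f(b)=\frac{1}{\Gamma(\alpha)}\int_{x}^{b}(b-t)^{\alpha-1}f(t)\,dt$ (equal to $0$ when the interval of integration is a single point). For $a,b\in I$ with $a<b$, $x\in[a,b]$, $\lambda\in[0,1]$ and $\alpha>0$, define $$S_{f}(x,\lambda,\alpha,a,b)=(1-\lambda)\left[\frac{(x-a)^{\alpha}+(b-x)^{\alpha}}{b-a}\right]f(x)+\lambda\left[\frac{(x-a)^{\alpha}f(a)+(b-x)^{\alpha}f(b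)}{b-a}\right]-\frac{\Gamma(\alpha+1)}{b-a}\left[J_{x^{-}}^{\alpha}f(a)+J_{x^{+}}^{\alpha}f(b)\right].$$
   Formalization: The formal theorem also assumes f is continuous on [a,b]; without this the identity fails if f jumps at an endpoint of I (I=[a,b], f(a)=1, f=0 on (a,b], λ=α=1, x=b gives 1=0). *)

theory Defs
  imports "HOL-Analysis.Analysis"
begin

text \<open>Riemann--Liouville fractional integrals of order \<open>\<alpha>\<close> based at \<open>x\<close>:
  \<open>rl_minus \<alpha> x f a\<close> is $J_{x^-}^{\alpha} f(a)$ for \<open>a \<le> x\<close>, and
  \<open>rl_plus \<alpha> x f b\<close> is $J_{x^+}^{\alpha} f(b)$ for \<open>x \<le> b\<close>.
  The value \<open>0 powr (\<alpha> - 1) = 0\<close> at the singular endpoint affects only a null set.\<close>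

definition rl_minus :: "real \<Rightarrow> real \<Rightarrow> (real \<Rightarrow> real) \<Rightarrow> real \<Rightarrow> real" where
  "rl_minus \<alpha> x f a =
     1 / Gamma \<alpha> * (LINT t:{a..x}|lebesgue. (t - a) powr (\<alpha> - 1) * f t)"

definition rl_plus :: "real \<Rightarrow> real \<Rightarrow> (real \<Rightarrow> real) \<Rightarrow> real \<Rightarrow> real" where
  "rl_plus \<alpha> x f b =
     1 / Gamma \<alpha> * (LINT t:{x..b}|lebesgue. (b - t) powr (\<alpha> - 1) * f t)"

definition S_frac ::
  "(real \<Rightarrow> real) \<Rightarrow> real \<Rightarrow> real \<Rightarrow> real \<Rightarrow> real \<Rightarrow> real \<Rightarrow> real" where
  "S_frac f x \<mu> \<alpha> a b =
     (1 - \<mu>) * (((x - a) powr \<alpha> + (b - x) powr \<alpha>) / (b - a)) * f x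
     + \<mu> * (((x - a) powr \<alpha> * f a + (b - x) powr \<alpha> * f b) / (b - a))
     - Gamma (\<alpha> + 1) / (b - a) * (rl_minus \<alpha> x f a + rl_plus \<alpha> x f b)"

end

theory Submission
  imports Defs
begin

text \<open>Parametrise the segment from an endpoint \<open>c \<in> {a, b}\<close> to \<open>x\<close> by
  \<open>g t = f (t * x + (1 - t) * c)\<close>. Integrating \<open>(t powr \<alpha> - \<mu>) * g' t\<close> by parts over \<open>[0, 1]\<close>
  gives the two boundary terms and, after substituting back, the fractional integral of \<open>f\<close>.
  The orientation of the segment enters only through the sign of \<open>x - c\<close>, so the cases
  \<open>c = a\<close> and \<open>c = b\<close> are treated at once and summed.\<close>

text \<open>A continuous factor is measurable and, on the compact interval, bounded.\<close>

lemma absolutely_integrable_continuous_mult: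
  fixes f g :: "real \<Rightarrow> real"
  assumes "continuous_on {a..b} f" "g absolutely_integrable_on {a..b}"
  shows "(\<lambda>t. f t * g t) absolutely_integrable_on {a..b}"
  using assms
  by (intro absolutely_integrable_bounded_measurable_product_real
      continuous_imp_measurable_on_sets_lebesgue compact_imp_bounded compact_continuous_image) auto

lemma absolutely_integrable_powr_unit_interval:
  fixes \<alpha> :: real
  assumes "\<alpha> > 0"
  shows "(\<lambda>t. t powr (\<alpha> - 1)) absolutely_integrable_on {0..1}"
  using integrable_on_powr_from_0[of "\<alpha> - 1" 1] assms
  by (intro nonnegative_absolutely_integrable_1) auto

text \<open>The product \<open>(t powr \<alpha> - \<mu>) * g t\<close> is an antiderivative of the
  sum of the two integrands. For \<alpha> < 1 the power has no finite derivative at 0, so the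
  fundamental theorem is used with continuity on the closed interval and derivatives only in its
  interior.\<close>

lemma integral_powr_deriv_by_parts:
  fixes g g' :: "real \<Rightarrow> real"
  assumes cont: "continuous_on {0..1} g"
    and der: "\<And>t. t \<in> {0<..<1} \<Longrightarrow> (g has_real_derivative g' t) (at t)"
    and int: "g' absolutely_integrable_on {0..1}"
    and \<alpha>: "\<alpha> > 0"
  shows "(LINT t:{0..1}|lebesgue. (t powr \<alpha> - \<mu>) * g' t)
    = (1 - \<mu>) * g 1 + \<mu> * g 0 - \<alpha> * (LINT t:{0..1}|lebesgue. t powr (\<alpha> - 1) * g t)"
proof -
  have cp: "continuous_on {0..1} (\<lambda>t. t powr \<alpha> - \<mu>)"
    using \<alpha> by (intro continuous_intros continuous_on_powr') auto
  have A: "(\<lambda>t. (t powr \<alpha> - \<mu>) * g' t) absolutely_integrable_on {0..1}"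
    by (rule absolutely_integrable_continuous_mult[OF cp int])
  \<comment> \<open>The roles switch here: \<open>g\<close> is the continuous factor, while the
    power, possibly unbounded near 0, is integrable because its exponent exceeds -1.\<close>
  have "(\<lambda>t. g t * t powr (\<alpha> - 1)) absolutely_integrable_on {0..1}"
    by (rule absolutely_integrable_continuous_mult[OF cont
          absolutely_integrable_powr_unit_interval[OF \<alpha>]])
  then have B: "(\<lambda>t. t powr (\<alpha> - 1) * g t) absolutely_integrable_on {0..1}"
    by (simp add: mult.commute)
  then have B': "(\<lambda>t. \<alpha> * (t powr (\<alpha> - 1) * g t)) absolutely_integrable_on {0..1}"
    by (rule set_integrable_mult_right)
  have "((\<lambda>t. \<alpha> * (t powr (\<alpha> - 1) * g t) + (t powr \<alpha> - \<mu>) * g' t) has_integral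
      (1 powr \<alpha> - \<mu>) * g 1 - (0 powr \<alpha> - \<mu>) * g 0) {0..1}"
  proof (rule fundamental_theorem_of_calculus_interior)
    show "continuous_on {0..1} (\<lambda>t. (t powr \<alpha> - \<mu>) * g t)"
      by (intro continuous_on_mult cp cont)
    fix t :: real
    assume t: "t \<in> {0<..<1}"
    then have "((\<lambda>t. (t powr \<alpha> - \<mu>) * g t) has_real_derivative
        \<alpha> * (t powr (\<alpha> - 1) * g t) + (t powr \<alpha> - \<mu>) * g' t) (at t)"
      by (auto intro!: derivative_eq_intros der simp: has_real_derivative_powr)
    then show "((\<lambda>t. (t powr \<alpha> - \<mu>) * g t) has_vector_derivative
        \<alpha> * (t powr (\<alpha> - 1) * g t) + (t powr \<alpha> - \<mu>) * g' t) (at t)"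
      by (simp add: has_real_derivative_iff_has_vector_derivative)
  qed simp
  \<comment> \<open>The fundamental theorem yields a gauge integral of the sum; absolute
    integrability of each summand splits it into two Lebesgue integrals.\<close>
  moreover have "((\<lambda>t. \<alpha> * (t powr (\<alpha> - 1) * g t) + (t powr \<alpha> - \<mu>) * g' t) has_integral
      \<alpha> * (LINT t:{0..1}|lebesgue. t powr (\<alpha> - 1) * g t)
        + (LINT t:{0..1}|lebesgue. (t powr \<alpha> - \<mu>) * g' t)) {0..1}"
    using has_integral_set_lebesgue[OF B'] has_integral_set_lebesgue[OF A]
    by (auto intro!: has_integral_add)
  ultimately have "(1 powr \<alpha> - \<mu>) * g 1 - (0 powr \<alpha> - \<mu>) * g 0
      = \<alpha> * (LINT t:{0..1}|lebesgue. t powr (\<alpha> - 1) * g t)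
        + (LINT t:{0..1}|lebesgue. (t powr \<alpha> - \<mu>) * g' t)"
    by (rule has_integral_unique)
  then show ?thesis
    by simp
qed

text \<open>Affine change of variables with Jacobian \<open>\<bar>x - c\<bar>\<close>. Using
  \<open>closed_segment\<close> covers both orders of \<open>c\<close> and \<open>x\<close>.\<close>

lemma absolutely_integrable_segment:
  fixes h :: "real \<Rightarrow> real"
  assumes "c \<noteq> x"
  shows "(\<lambda>t. h (t * x + (1 - t) * c)) absolutely_integrable_on {0..1}
      \<longleftrightarrow> h absolutely_integrable_on closed_segment c x" (is ?iff)
    and "h absolutely_integrable_on closed_segment c x \<Longrightarrow>
      \<bar>x - c\<bar> * (LINT t:{0..1}|lebesgue. h (t * x + (1 - t) * c))
        = (LINT s:closed_segment c x|lebesgue. h s)"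
proof -
  have img: "(\<lambda>t. t * x + (1 - t) * c) ` {0..1} = closed_segment c x"
    by (simp add: closed_segment_image_interval add.commute)
  have inj: "inj_on (\<lambda>t. t * x + (1 - t) * c) {0..1}"
  proof (rule inj_onI)
    fix t u
    assume "t * x + (1 - t) * c = u * x + (1 - u) * c"
    then have "(t - u) * (x - c) = 0"
      by (simp add: algebra_simps)
    then show "t = u"
      using assms by simp
  qed
  \<comment> \<open>Leaving \<open>v\<close> arbitrary lets one equivalence transfer integrability
    in both directions as well as the value of the integral.\<close>
  have *: "(\<lambda>t. \<bar>x - c\<bar> * h (t * x + (1 - t) * c)) absolutely_integrable_on {0..1} \<and>
      integral {0..1} (\<lambda>t. \<bar>x - c\<bar> * h (t * x + (1 - t) * c)) = v
    \<longleftrightarrow> h absolutely_integrable_on closed_segment c x \<and> integral (closed_segment c x) h = v" for v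
    unfolding img[symmetric]
    by (rule has_absolute_integral_change_of_variables_1')
      (auto intro!: derivative_eq_intros inj)
  have scale: "(\<lambda>t. \<bar>x - c\<bar> * h (t * x + (1 - t) * c)) absolutely_integrable_on {0..1}
      \<longleftrightarrow> (\<lambda>t. h (t * x + (1 - t) * c)) absolutely_integrable_on {0..1}"
    using assms by simp
  show iff: ?iff
    using * scale by blast
  assume h: "h absolutely_integrable_on closed_segment c x"
  then have "integral {0..1} (\<lambda>t. \<bar>x - c\<bar> * h (t * x + (1 - t) * c)) = integral (closed_segment c x) h"
    using * by blast
  then show "\<bar>x - c\<bar> * (LINT t:{0..1}|lebesgue. h (t * x + (1 - t) * c))
        = (LINT s:closed_segment c x|lebesgue. h s)"
    using h iff by (simp add: set_lebesgue_integral_eq_integral(2))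
qed

text \<open>This form serves the weighted integrand, whose integrability is easiest to see on the
  unit interval.\<close>

lemma set_lebesgue_integral_segment:
  fixes h :: "real \<Rightarrow> real"
  assumes "c \<noteq> x" "(\<lambda>t. h (t * x + (1 - t) * c)) absolutely_integrable_on {0..1}"
  shows "\<bar>x - c\<bar> * (LINT t:{0..1}|lebesgue. h (t * x + (1 - t) * c))
        = (LINT s:closed_segment c x|lebesgue. h s)"
  using absolutely_integrable_segment[OF assms(1), of h] assms(2) by blast

text \<open>Integration by parts for the pullback of \<open>f\<close>, multiplied through by
  \<open>\<bar>x - c\<bar> powr \<alpha>\<close>. The signed factor \<open>x - c\<close> comes from
  the chain rule and carries the orientation.\<close>

lemma segment_integral_by_parts:
  fixes f f' :: "real \<Rightarrow> real"
  assumes cont: "continuous_on (closed_segment c x) f"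
    and der: "\<And>s. s \<in> open_segment c x \<Longrightarrow> (f has_real_derivative f' s) (at s)"
    and int: "f' absolutely_integrable_on closed_segment c x"
    and \<alpha>: "\<alpha> > 0"
  shows "\<bar>x - c\<bar> powr \<alpha> * (x - c)
      * (LINT t:{0..1}|lebesgue. (t powr \<alpha> - \<mu>) * f' (t * x + (1 - t) * c))
    = \<bar>x - c\<bar> powr \<alpha> * ((1 - \<mu>) * f x + \<mu> * f c)
      - \<alpha> * (LINT s:closed_segment c x|lebesgue. \<bar>s - c\<bar> powr (\<alpha> - 1) * f s)"
proof (cases "c = x")
  case True
  \<comment> \<open>On the degenerate segment every term vanishes, since \<open>0 powr r = 0\<close>
    for every \<open>r\<close>.\<close>
  have "(LINT s:{x}|lebesgue. \<bar>s - x\<bar> powr (\<alpha> - 1) * f s) = (LINT s:{x}|lebesgue. 0)"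
    by (intro set_lebesgue_integral_cong) auto
  then show ?thesis
    using True by (simp add: set_lebesgue_integral_def)
next
  case False
  define p where "p t = t * x + (1 - t) * c" for t
  have p_closed: "p ` {0..1} = closed_segment c x"
    by (simp add: p_def closed_segment_image_interval add.commute)
  have p_open: "p t \<in> open_segment c x" if "t \<in> {0<..<1}" for t
    using that False by (auto simp: p_def open_segment_image_interval add.commute)
  have cont_g: "continuous_on {0..1} (\<lambda>t. f (p t))"
    by (rule continuous_on_compose2[OF cont])
      (auto simp: p_closed[symmetric] intro!: continuous_intros simp: p_def)
  have der_g: "((\<lambda>t. f (p t)) has_real_derivative (x - c) * f' (p t)) (at t)"
    if "t \<in> {0<..<1}" for t
  proof -
    have "(p has_real_derivative x - c) (at t)"
      unfolding p_def by (auto intro!: derivative_eq_intros)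
    then show ?thesis
      using DERIV_chain2[where f = f and g = p, OF der[OF p_open[OF that]]] by (simp add: mult.commute)
  qed
  have int_g: "(\<lambda>t. (x - c) * f' (p t)) absolutely_integrable_on {0..1}"
    using absolutely_integrable_segment(1)[OF False, of f'] int by (simp add: p_def)
  have *: "(x - c) * (LINT t:{0..1}|lebesgue. (t powr \<alpha> - \<mu>) * f' (p t))
      = (1 - \<mu>) * f x + \<mu> * f c - \<alpha> * (LINT t:{0..1}|lebesgue. t powr (\<alpha> - 1) * f (p t))"
    using integral_powr_deriv_by_parts[OF cont_g der_g int_g \<alpha>, of \<mu>]
    by (simp add: p_def mult.left_commute[of _ "x - c"])
  have dist: "\<bar>p t - c\<bar> powr (\<alpha> - 1) = \<bar>x - c\<bar> powr (\<alpha> - 1) * t powr (\<alpha> - 1)"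
    if "t \<in> {0..1}" for t
  proof -
    have "p t - c = t * (x - c)"
      by (simp add: p_def algebra_simps)
    then show ?thesis
      using that by (simp add: abs_mult powr_mult mult.commute)
  qed
  have "(\<lambda>t. f (p t) * t powr (\<alpha> - 1)) absolutely_integrable_on {0..1}"
    by (rule absolutely_integrable_continuous_mult[OF cont_g
          absolutely_integrable_powr_unit_interval[OF \<alpha>]])
  then have "(\<lambda>t. \<bar>x - c\<bar> powr (\<alpha> - 1) * (t powr (\<alpha> - 1) * f (p t))) absolutely_integrable_on {0..1}"
    by (simp add: mult.commute)
  also have "?this \<longleftrightarrow> (\<lambda>t. \<bar>p t - c\<bar> powr (\<alpha> - 1) * f (p t)) absolutely_integrable_on {0..1}"
    by (intro set_integrable_cong) (simp_all add: dist)
  finally have "(LINT s:closed_segment c x|lebesgue. \<bar>s - c\<bar> powr (\<alpha> - 1) * f s)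
      = \<bar>x - c\<bar> * (LINT t:{0..1}|lebesgue. \<bar>p t - c\<bar> powr (\<alpha> - 1) * f (p t))"
    using set_lebesgue_integral_segment[OF False, of "\<lambda>s. \<bar>s - c\<bar> powr (\<alpha> - 1) * f s"]
    by (simp add: p_def)
  also have "(LINT t:{0..1}|lebesgue. \<bar>p t - c\<bar> powr (\<alpha> - 1) * f (p t))
      = (LINT t:{0..1}|lebesgue. \<bar>x - c\<bar> powr (\<alpha> - 1) * (t powr (\<alpha> - 1) * f (p t)))"
    by (intro set_lebesgue_integral_cong) (simp_all add: dist)
  also have "\<dots> = \<bar>x - c\<bar> powr (\<alpha> - 1) * (LINT t:{0..1}|lebesgue. t powr (\<alpha> - 1) * f (p t))"
    by (rule set_integral_mult_right)
  \<comment> \<open>The Jacobian raises the exponent of the scaled weight from \<alpha> - 1 to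
    \<alpha>.\<close>
  also have "\<bar>x - c\<bar> * \<dots> = \<bar>x - c\<bar> powr \<alpha> * (LINT t:{0..1}|lebesgue. t powr (\<alpha> - 1) * f (p t))"
    using False powr_mult_base[of "\<bar>x - c\<bar>" "\<alpha> - 1"] by (simp add: mult.assoc[symmetric])
  finally have "(LINT s:closed_segment c x|lebesgue. \<bar>s - c\<bar> powr (\<alpha> - 1) * f s)
      = \<bar>x - c\<bar> powr \<alpha> * (LINT t:{0..1}|lebesgue. t powr (\<alpha> - 1) * f (p t))" .
  then show ?thesis
    unfolding p_def[symmetric] mult.assoc * by (simp add: right_diff_distrib)
qed

theorem lemma1:
  fixes I :: "real set" and f :: "real \<Rightarrow> real" and a b x \<mu> \<alpha> :: real
  assumes "is_interval I"
    and "f differentiable_on interior I"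
    and "a \<in> I" and "b \<in> I" and "a < b"
    and "continuous_on {a..b} f"
    and "deriv f absolutely_integrable_on {a..b}"
    and "x \<in> {a..b}" and "\<mu> \<in> {0..1}" and "\<alpha> > 0"
  shows "S_frac f x \<mu> \<alpha> a b =
      (x - a) powr (\<alpha> + 1) / (b - a)
        * (LINT t:{0..1}|lebesgue. (t powr \<alpha> - \<mu>) * deriv f (t * x + (1 - t) * a))
    + (b - x) powr (\<alpha> + 1) / (b - a)
        * (LINT t:{0..1}|lebesgue. (\<mu> - t powr \<alpha>) * deriv f (t * x + (1 - t) * b))"
proof -
  have x: "a \<le> x" "x \<le> b"
    using assms by auto
  have "{a<..<b} \<subseteq> I"
    using mem_is_interval_1_I[OF assms(1,3,4)] by auto
  \<comment> \<open>The points \<open>a\<close> and \<open>b\<close> may lie on the boundary of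
    \<open>I\<close>, so derivatives are taken only strictly between them; the assumed continuity
    covers the endpoints.\<close>
  then have sub: "{a<..<b} \<subseteq> interior I"
    by (simp add: interior_maximal)
  have der: "(f has_real_derivative deriv f s) (at s)" if "s \<in> {a<..<b}" for s
    using assms(2) sub that open_interior[of I]
    by (metis DERIV_deriv_iff_real_differentiable at_within_open differentiable_on_def subsetD)
  have identity: "\<bar>x - c\<bar> powr \<alpha> * (x - c)
      * (LINT t:{0..1}|lebesgue. (t powr \<alpha> - \<mu>) * deriv f (t * x + (1 - t) * c))
    = \<bar>x - c\<bar> powr \<alpha> * ((1 - \<mu>) * f x + \<mu> * f c)
      - \<alpha> * (LINT s:closed_segment c x|lebesgue. \<bar>s - c\<bar> powr (\<alpha> - 1) * f s)"
    if "c \<in> {a, b}" for c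
  proof (rule segment_integral_by_parts[OF _ _ _ \<open>\<alpha> > 0\<close>])
    have sub: "closed_segment c x \<subseteq> {a..b}"
      using that x by (auto simp: closed_segment_eq_real_ivl)
    show "continuous_on (closed_segment c x) f"
      by (rule continuous_on_subset[OF assms(6) sub])
    show "deriv f absolutely_integrable_on closed_segment c x"
      by (rule set_integrable_subset[OF assms(7) _ sub])
        (simp add: closed_segment_eq_real_ivl)
    show "(f has_real_derivative deriv f s) (at s)" if "s \<in> open_segment c x" for s
      using that \<open>c \<in> {a, b}\<close> x
      by (intro der) (auto simp: open_segment_eq_real_ivl split: if_splits)
  qed
  let ?Ja = "LINT t:{a..x}|lebesgue. (t - a) powr (\<alpha> - 1) * f t"
  let ?Jb = "LINT t:{x..b}|lebesgue. (b - t) powr (\<alpha> - 1) * f t"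
  let ?Ia = "LINT t:{0..1}|lebesgue. (t powr \<alpha> - \<mu>) * deriv f (t * x + (1 - t) * a)"
  let ?Ib = "LINT t:{0..1}|lebesgue. (\<mu> - t powr \<alpha>) * deriv f (t * x + (1 - t) * b)"
  have Ja: "(LINT s:closed_segment a x|lebesgue. \<bar>s - a\<bar> powr (\<alpha> - 1) * f s) = ?Ja"
    using x by (auto simp: closed_segment_eq_real_ivl intro!: set_lebesgue_integral_cong)
  have Jb: "(LINT s:closed_segment b x|lebesgue. \<bar>s - b\<bar> powr (\<alpha> - 1) * f s) = ?Jb"
    using x by (auto simp: closed_segment_eq_real_ivl abs_if intro!: set_lebesgue_integral_cong)
  \<comment> \<open>The reversed sign of this integrand compensates for
    \<open>x - b = - (b - x)\<close> in the case \<open>c = b\<close>.\<close>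
  have "(\<lambda>t. (\<mu> - t powr \<alpha>) * deriv f (t * x + (1 - t) * b))
      = (\<lambda>t. - ((t powr \<alpha> - \<mu>) * deriv f (t * x + (1 - t) * b)))"
    by (auto simp: algebra_simps)
  then have Ib: "(LINT t:{0..1}|lebesgue. (t powr \<alpha> - \<mu>) * deriv f (t * x + (1 - t) * b)) = - ?Ib"
    by (simp add: set_lebesgue_integral_def)
  have A: "(x - a) powr (\<alpha> + 1) * ?Ia
      = (x - a) powr \<alpha> * ((1 - \<mu>) * f x + \<mu> * f a) - \<alpha> * ?Ja"
    using identity[of a] x by (simp add: Ja powr_add)
  have B: "(b - x) powr (\<alpha> + 1) * ?Ib
      = (b - x) powr \<alpha> * ((1 - \<mu>) * f x + \<mu> * f b) - \<alpha> * ?Jb"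
  proof -
    have "(b - x) powr \<alpha> * (x - b) * - ?Ib
        = (b - x) powr \<alpha> * ((1 - \<mu>) * f x + \<mu> * f b) - \<alpha> * ?Jb"
      using identity[of b] x by (simp add: Jb Ib abs_minus_commute[of x])
    moreover have "(b - x) powr (\<alpha> + 1) = - ((b - x) powr \<alpha> * (x - b))"
      using x by (simp add: powr_add algebra_simps)
    ultimately show ?thesis
      by simp
  qed
  \<comment> \<open>Being nonzero, \<open>Gamma \<alpha>\<close> cancels against the normalisation
    of the fractional integrals, leaving the factor \<alpha> produced by the integration by
    parts.\<close>
  have "Gamma \<alpha> > 0"
    using assms(10) by (rule Gamma_real_pos)
  moreover have "Gamma (\<alpha> + 1) = \<alpha> * Gamma \<alpha>"
    using assms(10) by (intro Gamma_plus1) (auto elim: nonpos_Ints_cases)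
  ultimately have G: "Gamma (\<alpha> + 1) / (b - a) * (rl_minus \<alpha> x f a + rl_plus \<alpha> x f b)
      = (\<alpha> * ?Ja + \<alpha> * ?Jb) / (b - a)"
    by (simp add: rl_minus_def rl_plus_def distrib_left add_divide_distrib)
  \<comment> \<open>Here \<open>p\<close>, \<open>q\<close> stand for the powers of
    \<open>x - a\<close> and \<open>b - x\<close>, and \<open>u\<close>, \<open>v\<close> for the
    unnormalised fractional integrals; what remains is regrouping by endpoint.\<close>
  have algebra: "(1 - \<mu>) * ((p + q) / (b - a)) * f x + \<mu> * ((p * f a + q * f b) / (b - a))
      - (\<alpha> * u + \<alpha> * v) / (b - a)
    = (p * ((1 - \<mu>) * f x + \<mu> * f a) - \<alpha> * u + (q * ((1 - \<mu>) * f x + \<mu> * f b) - \<alpha> * v)) / (b - a)"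
    for p q u v
    using assms(5) by (simp add: divide_simps) (simp add: algebra_simps)
  have "S_frac f x \<mu> \<alpha> a b
      = ((x - a) powr (\<alpha> + 1) * ?Ia + (b - x) powr (\<alpha> + 1) * ?Ib) / (b - a)"
    unfolding S_frac_def G A B by (rule algebra)
  then show ?thesis
    by (simp add: add_divide_distrib)
qed

end
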